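(* Let $n\in\mathbb{N}$ with $n\le 7$. Then for every $a\in\mathbb{R}^n$, $$P\left(|a\cdot\epsilon|\ge\|a\|\right)\ge\frac{7}{32}.$$
   Context: $\epsilon=(\epsilon_1,\dots,\epsilon_n)$, where $\epsilon_1,\dots,\epsilon_n$ are independent random variables with $P(\epsilon_i=1)=P(\epsilon_i=-1)=\frac12$. For $a=(a_1,\dots,a_n)\in\mathbb{R}^n$, $a\cdot\epsilon=a_1\epsilon_1+\cdots+a_n\epsilon_n$ and $\|a\|=(\sum_{i=1}^n a_i^2)^{1/2}$. *)

theory Defs
  imports "HOL-Probability.Probability"
begin

end

theory Submission
  imports Defs
begin

text \<open>
  Only the moduli of the coefficients matter, and zeros may be appended, so the question is about
  reals \<open>b 1 \<ge> \<dots> \<ge> b 7 \<ge> 0\<close> and the signed sums \<open>S A = T - 2 * sum b A\<close>, where \<open>T\<close> is the sum of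
  all the \<open>b i\<close> and \<open>A\<close> is the set of indices with a minus sign. Let \<open>r\<close> be the Euclidean norm of \<open>b\<close>.
  Complementing \<open>A\<close> negates \<open>S A\<close>, so it is enough to find 14 of the 128 subsets with \<open>S A \<ge> r\<close>.

  The inequality \<open>S A \<ge> r\<close> says that the subset sum of \<open>A\<close> is at most \<open>\<theta> = (T - r) / 2\<close>; call
  such an \<open>A\<close> light, and heavy otherwise. A light set stays light when elements are dropped or
  replaced by larger indices, so it brings many others with it: each of {1,7}, {2,6},
  {3,5}, {4,5,7} alone yields 14 light sets, and so does {3,6} together with {4,6,7} (lemma
  \<open>fourteen_light_subsets\<close>).

  Suppose all these options fail. Then \<open>S A\<close> is less than \<open>r\<close>, in fact less than \<open>r\<close> in modulus,
  for {1,7}, {2,6}, {3,5}, {4,5,7} and for one of {3,6} and {4,6,7}. But then a weighted mean of the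
  squares \<open>(S A)\<^sup>2\<close> over these sets is less than \<open>r\<^sup>2\<close>. The lemmas \<open>squares_bound_without_36\<close> and
  \<open>squares_bound_without_467\<close> exhibit, in the two cases, weights for which this mean is at least
  \<open>r\<^sup>2\<close> for every decreasing nonnegative \<open>b\<close>.

  The bound is attained by six equal coefficients: there exactly the sums with at most one or at
  least five minus signs count, which is 14 sign vectors of 64.
\<close>

section \<open>Two inequalities for decreasing sequences of seven reals\<close>

text \<open>
  The weights 2, 3, 3, 4 add up to 12, so only products of two different variables survive in the
  difference of the two sides. The weights are chosen such that this quadratic form has only
  nonnegative coefficients once it is written in the successive differences and the last entry of
  the sequence, which amounts to a system of linear inequalities for them.
\<close>

lemma squares_bound_without_36:
  fixes b1 b2 b3 b4 b5 b6 b7 :: real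
  assumes ord: "b1 \<ge> b2" "b2 \<ge> b3" "b3 \<ge> b4" "b4 \<ge> b5" "b5 \<ge> b6" "b6 \<ge> b7" "b7 \<ge> 0"
    and T: "T = b1 + b2 + b3 + b4 + b5 + b6 + b7"
    and R: "R = b1\<^sup>2 + b2\<^sup>2 + b3\<^sup>2 + b4\<^sup>2 + b5\<^sup>2 + b6\<^sup>2 + b7\<^sup>2"
  shows "12 * R \<le> 2 * (T - 2 * (b1 + b7))\<^sup>2 + 3 * (T - 2 * (b4 + b5 + b7))\<^sup>2
    + 3 * (T - 2 * (b3 + b6))\<^sup>2 + 4 * (T - 2 * (b2 + b6))\<^sup>2"
proof -
  define d1 d2 d3 d4 d5 d6 where
    "d1 = b1 - b2" "d2 = b2 - b3" "d3 = b3 - b4" "d4 = b4 - b5" "d5 = b5 - b6" "d6 = b6 - b7"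
  note d = this
  have nonneg: "0 \<le> d1" "0 \<le> d2" "0 \<le> d3" "0 \<le> d4" "0 \<le> d5" "0 \<le> d6"
    using ord by (simp_all add: d)
  have "2 * (T - 2 * (b1 + b7))\<^sup>2 + 3 * (T - 2 * (b4 + b5 + b7))\<^sup>2
      + 3 * (T - 2 * (b3 + b6))\<^sup>2 + 4 * (T - 2 * (b2 + b6))\<^sup>2 - 12 * R
    = 4*d1*d3 + 8*d1*d4 + 12*d1*d5 + 12*d1*b7 + 8*d3*d6 + 24*d4*d5 + 16*d4*d6 + 24*d4*b7
      + 24*d5*d5 + 24*d5*d6 + 48*d5*b7"
    by (simp add: d T R power2_eq_square algebra_simps)
  moreover have "\<dots> \<ge> 0"
    using nonneg ord(7) by (intro add_nonneg_nonneg mult_nonneg_nonneg) auto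
  ultimately show ?thesis
    by linarith
qed

text \<open>
  The same principle for the sets available when {4,6,7} is heavy; here the weights add up to 84.
\<close>

lemma squares_bound_without_467:
  fixes b1 b2 b3 b4 b5 b6 b7 :: real
  assumes ord: "b1 \<ge> b2" "b2 \<ge> b3" "b3 \<ge> b4" "b4 \<ge> b5" "b5 \<ge> b6" "b6 \<ge> b7" "b7 \<ge> 0"
    and T: "T = b1 + b2 + b3 + b4 + b5 + b6 + b7"
    and R: "R = b1\<^sup>2 + b2\<^sup>2 + b3\<^sup>2 + b4\<^sup>2 + b5\<^sup>2 + b6\<^sup>2 + b7\<^sup>2"
  shows "84 * R \<le> 14 * (T - 2 * (b1 + b7))\<^sup>2 + 15 * (T - 2 * (b4 + b6 + b7))\<^sup>2
    + 33 * (T - 2 * (b3 + b5))\<^sup>2 + 16 * (T - 2 * (b2 + b6))\<^sup>2 + 6 * (T - 2 * (b4 + b5 + b7))\<^sup>2"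
proof -
  define d1 d2 d3 d4 d5 d6 where
    "d1 = b1 - b2" "d2 = b2 - b3" "d3 = b3 - b4" "d4 = b4 - b5" "d5 = b5 - b6" "d6 = b6 - b7"
  note d = this
  have nonneg: "0 \<le> d1" "0 \<le> d2" "0 \<le> d3" "0 \<le> d4" "0 \<le> d5" "0 \<le> d6"
    using ord by (simp_all add: d)
  have "14 * (T - 2 * (b1 + b7))\<^sup>2 + 15 * (T - 2 * (b4 + b6 + b7))\<^sup>2
      + 33 * (T - 2 * (b3 + b5))\<^sup>2 + 16 * (T - 2 * (b2 + b6))\<^sup>2
      + 6 * (T - 2 * (b4 + b5 + b7))\<^sup>2 - 84 * R
    = 48*d1*d2 + 28*d1*d3 + 56*d1*d4 + 12*d1*d5 + 84*d1*b7 + 48*d2*d2 + 48*d2*d3 + 96*d2*d4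
      + 96*d2*d6 + 144*d2*b7 + 48*d3*d5 + 56*d3*d6 + 24*d4*d5 + 112*d4*d6 + 168*d4*b7
      + 24*d5*d5 + 24*d5*d6"
    by (simp add: d T R power2_eq_square algebra_simps)
  moreover have "\<dots> \<ge> 0"
    using nonneg ord(7) by (intro add_nonneg_nonneg mult_nonneg_nonneg) auto
  ultimately show ?thesis
    by linarith
qed

section \<open>Fourteen light subsets\<close>

text \<open>
  Distinctness of concrete sets of numbers is decided by the simplifier through their binary codes,
  which turns it into distinctness of numerals.
\<close>

lemma card_ge_of_distinct_codes:
  fixes As :: "nat set list"
  assumes "finite F" and "set As \<subseteq> F" and "distinct (map (\<lambda>A. \<Sum>i\<in>A. 2 ^ i :: nat) As)"
  shows "length As \<le> card F"
proof -
  have "distinct As"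
    using assms(3) by (simp add: distinct_map)
  then show ?thesis
    using card_mono[OF assms(1,2)] by (simp add: distinct_card)
qed

text \<open>
  Each disjunct makes a set light, and the sets listed in the proof arise from it by dropping
  elements and by increasing indices, neither of which increases the subset sum. The last disjunct
  is a conjunction because {3,6} has only 13 sets below it, all of them with at most two elements,
  so that {4,6,7} is the fourteenth.
\<close>

lemma fourteen_light_subsets:
  fixes b :: "nat \<Rightarrow> real"
  assumes ord: "b 1 \<ge> b 2" "b 2 \<ge> b 3" "b 3 \<ge> b 4" "b 4 \<ge> b 5" "b 5 \<ge> b 6" "b 6 \<ge> b 7" "b 7 \<ge> 0"
    and light: "b 1 + b 7 \<le> \<theta> \<or> b 2 + b 6 \<le> \<theta> \<or> b 3 + b 5 \<le> \<theta> \<or> b 4 + b 5 + b 7 \<le> \<theta>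
      \<or> b 3 + b 6 \<le> \<theta> \<and> b 4 + b 6 + b 7 \<le> \<theta>"
  shows "14 \<le> card {A. A \<subseteq> {1..7} \<and> sum b A \<le> \<theta>}"
proof -
  let ?F = "{A. A \<subseteq> {1..7} \<and> sum b A \<le> \<theta>}"
  have fin: "finite ?F"
    by simp
  from light consider "b 1 + b 7 \<le> \<theta>" | "b 2 + b 6 \<le> \<theta>" | "b 3 + b 5 \<le> \<theta>"
    | "b 4 + b 5 + b 7 \<le> \<theta>" | "b 3 + b 6 \<le> \<theta>" "b 4 + b 6 + b 7 \<le> \<theta>"
    by blast
  then show ?thesis
  proof cases
    case 1
    have "set [{}, {1}, {2}, {3}, {4}, {5}, {6}, {7},
        {1,7}, {2,7}, {3,7}, {4,7}, {5,7}, {6,7}] \<subseteq> ?F"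
      using 1 ord by simp
    from card_ge_of_distinct_codes[OF fin this] show ?thesis
      by simp
  next
    case 2
    have "set [{}, {2}, {3}, {4}, {5}, {6}, {7},
        {2,6}, {2,7}, {3,6}, {3,7}, {4,6}, {4,7}, {5,6}] \<subseteq> ?F"
      using 2 ord by simp
    from card_ge_of_distinct_codes[OF fin this] show ?thesis
      by simp
  next
    case 3
    have "set [{}, {3}, {4}, {5}, {6}, {7},
        {3,5}, {3,6}, {3,7}, {4,5}, {4,6}, {4,7}, {5,6}, {5,7}] \<subseteq> ?F"
      using 3 ord by simp
    from card_ge_of_distinct_codes[OF fin this] show ?thesis
      by simp
  next
    case 4
    have "set [{}, {4}, {5}, {6}, {7}, {4,5}, {4,6}, {4,7}, {5,6}, {5,7}, {6,7},
        {4,5,7}, {4,6,7}, {5,6,7}] \<subseteq> ?F"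
      using 4 ord by simp
    from card_ge_of_distinct_codes[OF fin this] show ?thesis
      by simp
  next
    case 5
    have "set [{}, {3}, {4}, {5}, {6}, {7}, {3,6}, {3,7}, {4,6}, {4,7}, {5,6}, {5,7}, {6,7},
        {4,6,7}] \<subseteq> ?F"
      using 5 ord by simp
    from card_ge_of_distinct_codes[OF fin this] show ?thesis
      by simp
  qed
qed

section \<open>Large signed sums of seven decreasing reals\<close>

lemma fourteen_large_signed_sums:
  fixes b :: "nat \<Rightarrow> real"
  assumes ord: "b 1 \<ge> b 2" "b 2 \<ge> b 3" "b 3 \<ge> b 4" "b 4 \<ge> b 5" "b 5 \<ge> b 6" "b 6 \<ge> b 7" "b 7 \<ge> 0"
    and r: "r = sqrt (\<Sum>i=1..7. (b i)\<^sup>2)"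
  shows "14 \<le> card {A. A \<subseteq> {1..7} \<and> r \<le> sum b {1..7} - 2 * sum b A}"
proof -
  define T where "T = sum b {1..7}"
  have T: "T = b 1 + b 2 + b 3 + b 4 + b 5 + b 6 + b 7"
    by (simp add: T_def numeral_eq_Suc)
  have R: "r\<^sup>2 = (b 1)\<^sup>2 + (b 2)\<^sup>2 + (b 3)\<^sup>2 + (b 4)\<^sup>2 + (b 5)\<^sup>2 + (b 6)\<^sup>2 + (b 7)\<^sup>2"
    unfolding r by (subst real_sqrt_pow2) (auto intro: sum_nonneg simp: eval_nat_numeral)
  let ?\<theta> = "(T - r) / 2"
  have "b 1 + b 7 \<le> ?\<theta> \<or> b 2 + b 6 \<le> ?\<theta> \<or> b 3 + b 5 \<le> ?\<theta> \<or> b 4 + b 5 + b 7 \<le> ?\<theta>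
      \<or> b 3 + b 6 \<le> ?\<theta> \<and> b 4 + b 6 + b 7 \<le> ?\<theta>"
  proof (rule ccontr)
    assume neg: "\<not> ?thesis"
    then have upper: "T - 2 * (b 1 + b 7) < r" "T - 2 * (b 2 + b 6) < r"
      "T - 2 * (b 3 + b 5) < r" "T - 2 * (b 4 + b 5 + b 7) < r"
      by (auto simp: not_le field_simps)
    have sq: "x\<^sup>2 < r\<^sup>2" if "x < r" "- x < r" for x
      using that by (intro power2_strict_mono) auto
    (* Lower bounds on the sums: the one for {1,7} may be negative, but it and the one for {2,6}
       add up to 2 * (b 3 + b 4 + b 5), which is nonnegative; all the other sums considered here are nonnegative. *)
    have 17: "(T - 2 * (b 1 + b 7))\<^sup>2 < r\<^sup>2"
      using upper ord by (intro sq) (auto simp: T)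
    have 26: "(T - 2 * (b 2 + b 6))\<^sup>2 < r\<^sup>2"
      using upper ord by (intro sq) (auto simp: T)
    have 35: "(T - 2 * (b 3 + b 5))\<^sup>2 < r\<^sup>2"
      using upper ord by (intro sq) (auto simp: T)
    have 457: "(T - 2 * (b 4 + b 5 + b 7))\<^sup>2 < r\<^sup>2"
      using upper ord by (intro sq) (auto simp: T)
    from neg consider "T - 2 * (b 3 + b 6) < r" | "T - 2 * (b 4 + b 6 + b 7) < r"
      by (auto simp: not_le field_simps)
    then show False
    proof cases
      case 1
      then have "(T - 2 * (b 3 + b 6))\<^sup>2 < r\<^sup>2"
        using ord by (intro sq) (auto simp: T)
      then show False
        using squares_bound_without_36[OF ord T R] 17 26 457 by linarith
    next
      case 2
      then have "(T - 2 * (b 4 + b 6 + b 7))\<^sup>2 < r\<^sup>2"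
        using ord by (intro sq) (auto simp: T)
      then show False
        using squares_bound_without_467[OF ord T R] 17 26 35 457 by linarith
    qed
  qed
  from fourteen_light_subsets[OF ord this] show ?thesis
    by (simp add: T_def field_simps)
qed

text \<open>
  A set and its complement have opposite signed sums. For \<open>r > 0\<close> they cannot both be at least \<open>r\<close>,
  so the complements of the 14 sets are 14 new ones; for \<open>r = 0\<close> every subset qualifies.
\<close>

lemma twentyeight_large_signed_sums:
  fixes b :: "nat \<Rightarrow> real"
  assumes ord: "b 1 \<ge> b 2" "b 2 \<ge> b 3" "b 3 \<ge> b 4" "b 4 \<ge> b 5" "b 5 \<ge> b 6" "b 6 \<ge> b 7" "b 7 \<ge> 0"
    and r: "r = sqrt (\<Sum>i=1..7. (b i)\<^sup>2)"
  shows "28 \<le> card {A. A \<subseteq> {1..7} \<and> r \<le> \<bar>sum b {1..7} - 2 * sum b A\<bar>}"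
proof (cases "r = 0")
  case True
  then have "{A. A \<subseteq> {1..7::nat} \<and> r \<le> \<bar>sum b {1..7} - 2 * sum b A\<bar>} = Pow {1..7}"
    by auto
  then show ?thesis
    by (simp add: card_Pow)
next
  case False
  then have "r > 0"
    unfolding r by (simp add: sum_nonneg less_le)
  let ?S = "\<lambda>A. sum b {1..7} - 2 * sum b A"
  let ?D = "{A. A \<subseteq> {1..7} \<and> r \<le> ?S A}"
  let ?compl = "\<lambda>A. {1..7} - A"
  have flip: "?S (?compl A) = - ?S A" if "A \<subseteq> {1..7}" for A
    using that by (simp add: sum_diff)
  have inj: "inj_on ?compl ?D"
    by (auto intro!: inj_onI)
  have disj: "?D \<inter> ?compl ` ?D = {}"
  proof (rule ccontr)
    assume "?D \<inter> ?compl ` ?D \<noteq> {}"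
    then obtain A where "A \<subseteq> {1..7}" "r \<le> ?S A" "r \<le> ?S (?compl A)"
      by auto
    then show False
      using flip[of A] \<open>r > 0\<close> by linarith
  qed
  have "28 \<le> card ?D + card (?compl ` ?D)"
    using fourteen_large_signed_sums[OF ord r] card_image[OF inj] by simp
  also have "\<dots> = card (?D \<union> ?compl ` ?D)"
    using disj by (intro card_Un_disjoint[symmetric]) auto
  also have "\<dots> \<le> card {A. A \<subseteq> {1..7} \<and> r \<le> \<bar>?S A\<bar>}"
  proof (intro card_mono subsetI)
    fix B assume "B \<in> ?D \<union> ?compl ` ?D"
    then obtain A where "A \<subseteq> {1..7}" "r \<le> ?S A" "B = A \<or> B = ?compl A"
      by auto
    then show "B \<in> {A. A \<subseteq> {1..7} \<and> r \<le> \<bar>?S A\<bar>}"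
      using flip[of A] by auto
  qed simp
  finally show ?thesis .
qed

section \<open>Transfer to an index type with at most seven elements\<close>

lemma finite_type_antimono_enumeration:
  fixes w :: "'n::finite \<Rightarrow> real"
  obtains h where "bij_betw h {1..CARD('n)} (UNIV :: 'n set)"
    and "\<And>j k. 1 \<le> j \<Longrightarrow> j \<le> k \<Longrightarrow> k \<le> CARD('n) \<Longrightarrow> w (h k) \<le> w (h j)"
proof -
  obtain us :: "'n list" where us: "set us = UNIV" "distinct us"
    using finite_distinct_list[of "UNIV :: 'n set"] by auto
  define xs where "xs = sort_key (\<lambda>i. - w i) us"
  have xs: "set xs = UNIV" "distinct xs" and sorted: "sorted (map (\<lambda>i. - w i) xs)"
    using us by (auto simp: xs_def)
  have len: "length xs = CARD('n)"
    using distinct_card[OF xs(2)] xs(1) by simp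
  have "bij_betw ((!) xs) {..<CARD('n)} UNIV"
    using bij_betw_nth[OF xs(2)] xs(1) len by metis
  moreover have "bij_betw (\<lambda>k. k - 1) {1..CARD('n)} {..<CARD('n)}"
    by (rule bij_betwI[where g = Suc]) auto
  ultimately have "bij_betw ((!) xs \<circ> (\<lambda>k. k - 1)) {1..CARD('n)} UNIV"
    using bij_betw_trans by blast
  moreover have "w (xs ! (k - 1)) \<le> w (xs ! (j - 1))" if "1 \<le> j" "j \<le> k" "k \<le> CARD('n)" for j k
    using sorted_nth_mono[OF sorted, of "j - 1" "k - 1"] that len by simp
  ultimately show thesis
    using that[of "(!) xs \<circ> (\<lambda>k. k - 1)"] by simp
qed

text \<open>
  The weights are listed in decreasing order and continued by zeros up to length 7. A set of indices
  from 1 to 7 splits into a part that enumerates a set of original indices, which alone determines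
  the signed sum, and an arbitrary part beyond \<open>CARD('n)\<close>. Hence padding multiplies the number of
  large signed sums by \<open>2 ^ (7 - CARD('n))\<close>, the same factor as the number of all subsets.
\<close>

lemma large_signed_sums_at_most_seven:
  fixes w :: "'n::finite \<Rightarrow> real"
  assumes nonneg: "\<And>i. w i \<ge> 0" and seven: "CARD('n) \<le> 7"
  shows "7 * 2 ^ CARD('n) \<le> 32 * card {B. sqrt (\<Sum>i\<in>UNIV. (w i)\<^sup>2) \<le> \<bar>sum w UNIV - 2 * sum w B\<bar>}"
proof -
  let ?n = "CARD('n)"
  define r where "r = sqrt (\<Sum>i\<in>UNIV. (w i)\<^sup>2)"
  obtain h where h: "bij_betw h {1..?n} (UNIV :: 'n set)"
    and anti: "\<And>j k. 1 \<le> j \<Longrightarrow> j \<le> k \<Longrightarrow> k \<le> ?n \<Longrightarrow> w (h k) \<le> w (h j)"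
    using finite_type_antimono_enumeration[of w] by blast
  define b where "b k = (if k \<le> ?n then w (h k) else 0)" for k
  have ord: "b k \<le> b j" if "1 \<le> j" "j \<le> k" for j k
    using that anti nonneg by (auto simp: b_def)
  have b0: "b 7 \<ge> 0"
    using nonneg by (simp add: b_def)
  have restrict: "(\<Sum>k\<in>A. f (b k)) = (\<Sum>i\<in>h ` (A \<inter> {1..?n}). f (w i))"
    if "A \<subseteq> {1..7}" "f 0 = 0" for A and f :: "real \<Rightarrow> real"
  proof -
    have "(\<Sum>k\<in>A. f (b k)) = (\<Sum>k\<in>A \<inter> {1..?n}. f (b k))"
      using that finite_subset[OF that(1)] by (intro sum.mono_neutral_right) (auto simp: b_def)
    also have "\<dots> = (\<Sum>k\<in>A \<inter> {1..?n}. f (w (h k)))"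
      by (intro sum.cong) (auto simp: b_def)
    also have "\<dots> = (\<Sum>i\<in>h ` (A \<inter> {1..?n}). f (w i))"
      using inj_on_subset[OF bij_betw_imp_inj_on[OF h]]
      by (subst sum.reindex) auto
    finally show ?thesis .
  qed
  have all: "h ` ({1..7} \<inter> {1..?n}) = UNIV"
    using seven h by (simp add: bij_betw_def Int_absorb1)
  have r_b: "r = sqrt (\<Sum>k=1..7. (b k)\<^sup>2)"
    using restrict[of "{1..7}" "\<lambda>x. x\<^sup>2"] all by (simp add: r_def)
  let ?G = "{A. A \<subseteq> {1..7} \<and> r \<le> \<bar>sum b {1..7} - 2 * sum b A\<bar>}"
  let ?H = "{B. r \<le> \<bar>sum w UNIV - 2 * sum w B\<bar>}"
  let ?split = "\<lambda>A. (h ` (A \<inter> {1..?n}), A - {1..?n})"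
  have "28 \<le> card ?G"
    using ord b0 by (intro twentyeight_large_signed_sums r_b) auto
  also have "\<dots> \<le> card (?H \<times> Pow {?n + 1..7})"
  proof (rule card_inj_on_le)
    show "inj_on ?split ?G"
    proof (rule inj_onI)
      fix A A' assume eq: "?split A = ?split A'"
      then have "A \<inter> {1..?n} = A' \<inter> {1..?n}"
        using inj_on_image_eq_iff[OF bij_betw_imp_inj_on[OF h]] by (metis Int_lower2 prod.inject)
      then show "A = A'"
        using eq by auto
    qed
    show "?split ` ?G \<subseteq> ?H \<times> Pow {?n + 1..7}"
    proof
      fix p assume "p \<in> ?split ` ?G"
      then obtain A where A: "A \<subseteq> {1..7}" "r \<le> \<bar>sum b {1..7} - 2 * sum b A\<bar>" and p: "p = ?split A"
        by auto
      have "sum b A = sum w (h ` (A \<inter> {1..?n}))" "sum b {1..7} = sum w UNIV"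
        using restrict[of A "\<lambda>x. x"] restrict[of "{1..7}" "\<lambda>x. x"] A(1) all by auto
      then show "p \<in> ?H \<times> Pow {?n + 1..7}"
        using A p by auto
    qed
  qed simp
  also have "\<dots> = card ?H * 2 ^ (7 - ?n)"
    by (simp add: card_cartesian_product card_Pow)
  finally have "28 * 2 ^ ?n \<le> card ?H * (2 ^ (7 - ?n) * 2 ^ ?n)"
    by (simp add: mult_le_mono1 flip: mult.assoc)
  also have "(2::nat) ^ (7 - ?n) * 2 ^ ?n = 128"
    using seven by (simp flip: power_add)
  finally show ?thesis
    by (simp add: r_def)
qed

section \<open>Random signs\<close>

lemma (in prob_space) prob_sign_vector:
  fixes \<epsilon> :: "'n::finite \<Rightarrow> 'a \<Rightarrow> real"
  assumes indep: "indep_vars (\<lambda>_. borel) \<epsilon> UNIV"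
    and plus: "\<And>i. prob {\<omega> \<in> space M. \<epsilon> i \<omega> = 1} = 1 / 2"
    and minus: "\<And>i. prob {\<omega> \<in> space M. \<epsilon> i \<omega> = -1} = 1 / 2"
    and \<sigma>: "\<And>i. \<sigma> i \<in> {1, -1}"
  shows "prob {\<omega> \<in> space M. \<forall>i. \<epsilon> i \<omega> = \<sigma> i} = 1 / 2 ^ CARD('n)"
proof -
  have "{\<omega> \<in> space M. \<forall>i. \<epsilon> i \<omega> = \<sigma> i} = (\<Inter>i. \<epsilon> i -` {\<sigma> i} \<inter> space M)"
    by auto
  then have "prob {\<omega> \<in> space M. \<forall>i. \<epsilon> i \<omega> = \<sigma> i} = (\<Prod>i\<in>UNIV. prob (\<epsilon> i -` {\<sigma> i} \<inter> space M))"
    using indep_varsD[OF indep, of UNIV "\<lambda>i. {\<sigma> i}"] by simp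
  also have "\<dots> = (\<Prod>i\<in>(UNIV :: 'n set). 1 / 2)"
  proof (rule prod.cong[OF refl])
    fix i
    have "\<epsilon> i -` {\<sigma> i} \<inter> space M = {\<omega> \<in> space M. \<epsilon> i \<omega> = \<sigma> i}"
      by auto
    then show "prob (\<epsilon> i -` {\<sigma> i} \<inter> space M) = 1 / 2"
      using plus[of i] minus[of i] \<sigma>[of i] by auto
  qed
  finally show ?thesis
    by (simp add: power_one_over)
qed

theorem theorem3p1:
  fixes M :: "'w measure"
    and \<epsilon> :: "'n::finite \<Rightarrow> 'w \<Rightarrow> real"
    and a :: "real ^ 'n"
  assumes "prob_space M"
    and "prob_space.indep_vars M (\<lambda>_. borel) \<epsilon> UNIV"
    and "\<And>i. measure M {\<omega> \<in> space M. \<epsilon> i \<omega> = 1} = 1 / 2"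
    and "\<And>i. measure M {\<omega> \<in> space M. \<epsilon> i \<omega> = -1} = 1 / 2"
    and "CARD('n) \<le> 7"
  shows "measure M {\<omega> \<in> space M. \<bar>a \<bullet> (\<chi> i. \<epsilon> i \<omega>)\<bar> \<ge> norm a} \<ge> 7 / 32"
proof -
  interpret prob_space M
    by fact
  have meas[measurable]: "\<epsilon> i \<in> borel_measurable M" for i
    using assms(2) by (simp add: indep_vars_def)
  let ?n = "CARD('n)"
  let ?w = "\<lambda>i. \<bar>a $ i\<bar>"
  let ?H = "{B. norm a \<le> \<bar>sum ?w UNIV - 2 * sum ?w B\<bar>}"
  let ?E = "{\<omega> \<in> space M. norm a \<le> \<bar>a \<bullet> (\<chi> i. \<epsilon> i \<omega>)\<bar>}"
  (* On the event F B the terms a $ i * \<epsilon> i are negative exactly for the nonzero a $ i with i in B,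
     so that the signs of a are absorbed into those of the random variables. *)
  define \<sigma> where "\<sigma> B i = (if (i \<in> B) = (a $ i < 0) then 1 else -1 :: real)" for B i
  define F where "F B = {\<omega> \<in> space M. \<forall>i. \<epsilon> i \<omega> = \<sigma> B i}" for B
  have dot: "a \<bullet> (\<chi> i. \<epsilon> i \<omega>) = sum ?w UNIV - 2 * sum ?w B" if "\<omega> \<in> F B" for \<omega> B
  proof -
    have "a \<bullet> (\<chi> i. \<epsilon> i \<omega>) = (\<Sum>i\<in>UNIV. ?w i - 2 * (if i \<in> B then ?w i else 0))"
      using that by (auto simp: inner_vec_def F_def \<sigma>_def intro!: sum.cong)
    then show ?thesis
      by (simp add: sum_subtractf sum_distrib_left[symmetric] sum.If_cases)
  qed
  have "sqrt (\<Sum>i\<in>UNIV. (?w i)\<^sup>2) = norm a"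
    by (simp add: norm_vec_def L2_set_def)
  then have "7 * 2 ^ ?n \<le> 32 * card ?H"
    using large_signed_sums_at_most_seven[of ?w] assms(5) by simp
  then have "7 * 2 ^ ?n \<le> 32 * real (card ?H)"
    using of_nat_mono[of "7 * 2 ^ ?n" "32 * card ?H", where 'a = real] by simp
  then have "7 / 32 \<le> (\<Sum>B\<in>?H. 1 / 2 ^ ?n :: real)"
    by (simp add: field_simps)
  also have "\<dots> = (\<Sum>B\<in>?H. prob (F B))"
    using prob_sign_vector[OF assms(2-4)] by (simp add: F_def \<sigma>_def)
  also have "\<dots> = prob (\<Union>B\<in>?H. F B)"
  proof (rule finite_measure_finite_Union[symmetric])
    show "F ` ?H \<subseteq> events"
      by (auto simp: F_def)
    show "disjoint_family_on F ?H"
    proof (unfold disjoint_family_on_def, intro ballI impI)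
      fix B C :: "'n set" assume "B \<noteq> C"
      then obtain i where "(i \<in> B) \<noteq> (i \<in> C)"
        by blast
      then have "\<sigma> B i \<noteq> \<sigma> C i"
        by (auto simp: \<sigma>_def)
      then show "F B \<inter> F C = {}"
        by (auto simp: F_def)
    qed
  qed simp
  also have "\<dots> \<le> prob ?E"
  proof (rule finite_measure_mono)
    show "(\<Union>B\<in>?H. F B) \<subseteq> ?E"
      using dot by (auto simp: F_def)
    have "(\<lambda>\<omega>. a \<bullet> (\<chi> i. \<epsilon> i \<omega>)) \<in> borel_measurable M"
      by (simp add: inner_vec_def)
    then show "?E \<in> events"
      by measurable
  qed
  finally show ?thesis .
qed

end
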